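(* Consider the composite problem $\min_{x\in Q}\{f(x)=\mathcal{L}(x)+r(x)\}$ on a closed convex (possibly unbounded) set $Q\subseteq\mathbb{R}^n$, where $\mathcal{L}$ is $L_f$-smooth and $\mu$-strongly convex with $\mu\ge0$, and $r$ is convex. Let $\widetilde\nabla\mathcal{L}$ satisfy $\|\widetilde\nabla\mathcal{L}(x)-\nabla\mathcal{L}(x)\|_2\le\delta$ for all $x\in Q$, and let $\|\tilde x_0-x^*\|_2\le R$. Let $\{x_k\},\{\tilde x_k\},\{z_k\}$ be generated by the modified (composite) Algorithm STM$(L,\mu_\tau,x_{start})$ described in the context, and let $\tilde R_k$ be as in the context. (i) If $\mu\ne0$, then for all $N\ge0$: when the algorithm is run with $\tau=1$ (that is, $\mu_1=\mu$), $$f(x_N)-f(x^* )\le LR^2\exp\left(-\frac12\sqrt{\frac{\mu_1}{L}}\,N\right)+\left(1+\sqrt{\frac{L}{\mu_1}}\right)\delta_2+3\tilde R_N\delta_1,$$ and when the algorithm is run with $\tau=2$ (that is, $\mu_2=\mu/2$), $$f(x_N)-f(x^* )\le LR^2\exp\left(-\frac12\sqrt{\frac{\mu_2}{L}}\,N\right)+\left(1+\sqrt{\frac{L}{\mu_2}}\right)\delta_2+\left(1+\sqrt{\frac{L}{\mu_2}}\right)\delta_3.$$ (ii) If $\mu=0$ (so that $\mu_\tau=0$), then for all $N\ge1$, $$f(x_N)-f(x^* )\le\frac{4LR^2}{N^2}+3\tilde R_N\delta_1+N\delta_2.$$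
   Context: Setting: $x^*$ is a solution of $\min_{x\in Q}f(x)$ (if not unique, the one closest to $x_{start}$). $\mathcal{L}$ is $L_f$-smooth: $\|\nabla\mathcal{L}(x)-\nabla\mathcal{L}(y)\|_2\le L_f\|x-y\|_2$ for all $x,y\in Q$; and $\mu$-strongly convex: $\mathcal{L}(x)+\langle\nabla\mathcal{L}(x),y-x\rangle+\frac{\mu}{2}\|x-y\|_2^2\le\mathcal{L}(y)$ for all $x,y\in Q$ ($\mu=0$ means convex). The function $r$ is simple in the sense that the minimizers $z_k$ below exist and can be computed. Constants: $L=2L_f$, $\delta_1=\delta$, $\delta_2=\delta^2/L$, $\delta_3=\delta^2/\mu$ (if $\mu\neq0$); $\mu_1=\mu$, $\mu_2=\mu/2$ ($\tau=2$ is used only when $\mu\ne0$). Modified (composite) Algorithm STM$(L,\mu_\tau,x_{start})$, $x_{start}\in Q$: set $\tilde x_0=x_{start}$, $\alpha_0=A_0=1/L$, $\psi_0(x)=\frac12\|x-\tilde x_0\|_2^2+\alpha_0\left(\mathcal{L}(\tilde x_0)+\langle\widetilde\nabla\mathcal{L}(\tilde x_0),x-\tilde x_0\rangle+\frac{\mu_\tau}{2}\|x-\tilde x_0\|_2^2+r(x)\right)$, $z_0=\arg\min_{y\in Q}\psi_0(y)$, $x_0=z_0$. For $k=1,2,\dots$: let $\alpha_k=\frac{1+\mu_\tau A_{k-1}}{2L}+\sqrt{\frac{(1+\mu_\tau A_{k-1})^2}{4L^2}+\frac{A_{k-1}(1+\mu_\tau A_{k-1})}{L}}$ (the positive root of $(1+\mu_\tau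 A_{k-1})(A_{k-1}+\alpha_k)=L\alpha_k^2$), $A_k=A_{k-1}+\alpha_k$, $\tilde x_k=\frac{A_{k-1}x_{k-1}+\alpha_kz_{k-1}}{A_k}$, $\psi_k(x)=\psi_{k-1}(x)+\alpha_k\left(\mathcal{L}(\tilde x_k)+\langle\widetilde\nabla\mathcal{L}(\tilde x_k),x-\tilde x_k\rangle+\frac{\mu_\tau}{2}\|x-\tilde x_k\|_2^2+r(x)\right)$, $z_k=\arg\min_{y\in Q}\psi_k(y)$, $x_k=\frac{A_{k-1}x_{k-1}+\alpha_kz_k}{A_k}$. Notation: $\tilde R_k=\max_{0\le j\le k}\max\{\|z_j-x^*\|_2,\|x_j-x^*\|_2,\|\tilde x_j-x^*\|_2\}$. *)

theory Defs
  imports "HOL-Analysis.Analysis"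
begin

text \<open>
  The function \<open>G\<close> plays the role of the gradient of \<open>l\<close> on the feasible set \<open>Q\<close>. It is taken
  relative to \<open>Q\<close>, so that the values of \<open>l\<close> outside \<open>Q\<close> are irrelevant; at points interior to
  \<open>Q\<close> this is the usual gradient.
\<close>

definition gradient_on :: "'a::real_inner set \<Rightarrow> ('a \<Rightarrow> real) \<Rightarrow> ('a \<Rightarrow> 'a) \<Rightarrow> bool" where
  "gradient_on Q l G \<longleftrightarrow> (\<forall>x\<in>Q. (l has_derivative (\<lambda>h. G x \<bullet> h)) (at x within Q))"

definition L_smooth_on :: "real \<Rightarrow> 'a::real_inner set \<Rightarrow> ('a \<Rightarrow> real) \<Rightarrow> ('a \<Rightarrow> 'a) \<Rightarrow> bool" where
  "L_smooth_on L Q l G \<longleftrightarrow>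
     gradient_on Q l G \<and> (\<forall>x\<in>Q. \<forall>y\<in>Q. norm (G x - G y) \<le> L * norm (x - y))"

definition strongly_convex_on ::
    "real \<Rightarrow> 'a::real_inner set \<Rightarrow> ('a \<Rightarrow> real) \<Rightarrow> ('a \<Rightarrow> 'a) \<Rightarrow> bool" where
  "strongly_convex_on \<mu> Q l G \<longleftrightarrow>
     gradient_on Q l G \<and>
     (\<forall>x\<in>Q. \<forall>y\<in>Q. l x + G x \<bullet> (y - x) + \<mu> / 2 * (norm (x - y))\<^sup>2 \<le> l y)"

text \<open>
  Step sizes. \<open>stm_step L m a\<close> is the positive root \<open>\<alpha>\<close> of \<open>(1 + m * a) * (a + \<alpha>) = L * \<alpha>\<^sup>2\<close>.
\<close>

definition stm_step :: "real \<Rightarrow> real \<Rightarrow> real \<Rightarrow> real" where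
  "stm_step L m a =
     (1 + m * a) / (2 * L) + sqrt ((1 + m * a)\<^sup>2 / (4 * L\<^sup>2) + a * (1 + m * a) / L)"

primrec stm_A :: "real \<Rightarrow> real \<Rightarrow> nat \<Rightarrow> real" where
  "stm_A L m 0 = 1 / L"
| "stm_A L m (Suc k) = stm_A L m k + stm_step L m (stm_A L m k)"

primrec stm_alpha :: "real \<Rightarrow> real \<Rightarrow> nat \<Rightarrow> real" where
  "stm_alpha L m 0 = 1 / L"
| "stm_alpha L m (Suc k) = stm_step L m (stm_A L m k)"

text \<open>
  In the following, \<open>g\<close> is the inexact gradient of \<open>l\<close>, and \<open>xt\<close> is the sequence of points at which
  it is queried.
\<close>

definition stm_model ::
    "('a::real_inner \<Rightarrow> real) \<Rightarrow> ('a \<Rightarrow> 'a) \<Rightarrow> ('a \<Rightarrow> real) \<Rightarrow> real \<Rightarrow> 'a \<Rightarrow> 'a \<Rightarrow> real" where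
  "stm_model l g r m p x = l p + g p \<bullet> (x - p) + m / 2 * (norm (x - p))\<^sup>2 + r x"

primrec stm_psi ::
    "('a::real_inner \<Rightarrow> real) \<Rightarrow> ('a \<Rightarrow> 'a) \<Rightarrow> ('a \<Rightarrow> real) \<Rightarrow> real \<Rightarrow> real \<Rightarrow>
     (nat \<Rightarrow> 'a) \<Rightarrow> nat \<Rightarrow> 'a \<Rightarrow> real" where
  "stm_psi l g r L m xt 0 =
     (\<lambda>x. 1 / 2 * (norm (x - xt 0))\<^sup>2 + stm_alpha L m 0 * stm_model l g r m (xt 0) x)"
| "stm_psi l g r L m xt (Suc k) =
     (\<lambda>x. stm_psi l g r L m xt k x + stm_alpha L m (Suc k) * stm_model l g r m (xt (Suc k)) x)"

text \<open>
  \<open>stm_run Q l g r L m x_start xt z x\<close>: the sequences \<open>xt\<close>, \<open>z\<close>, \<open>x\<close> are generated by the composite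
  method with parameters \<open>L\<close>, \<open>m\<close> started at \<open>x_start\<close>. Existence of the minimizers \<open>z k\<close> is part
  of the predicate.
\<close>

definition stm_run ::
    "'a::real_inner set \<Rightarrow> ('a \<Rightarrow> real) \<Rightarrow> ('a \<Rightarrow> 'a) \<Rightarrow> ('a \<Rightarrow> real) \<Rightarrow> real \<Rightarrow> real \<Rightarrow> 'a \<Rightarrow>
     (nat \<Rightarrow> 'a) \<Rightarrow> (nat \<Rightarrow> 'a) \<Rightarrow> (nat \<Rightarrow> 'a) \<Rightarrow> bool" where
  "stm_run Q l g r L m x_start xt z x \<longleftrightarrow>
     xt 0 = x_start \<and>
     x 0 = z 0 \<and>
     (\<forall>k. is_arg_min (stm_psi l g r L m xt k) (\<lambda>y. y \<in> Q) (z k)) \<and>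
     (\<forall>k. xt (Suc k) =
        (stm_A L m k *\<^sub>R x k + stm_alpha L m (Suc k) *\<^sub>R z k) /\<^sub>R stm_A L m (Suc k)) \<and>
     (\<forall>k. x (Suc k) =
        (stm_A L m k *\<^sub>R x k + stm_alpha L m (Suc k) *\<^sub>R z (Suc k)) /\<^sub>R stm_A L m (Suc k))"

definition stm_radius ::
    "'a::real_normed_vector \<Rightarrow> (nat \<Rightarrow> 'a) \<Rightarrow> (nat \<Rightarrow> 'a) \<Rightarrow> (nat \<Rightarrow> 'a) \<Rightarrow> nat \<Rightarrow> real" where
  "stm_radius xs xt z x k =
     (MAX j\<in>{0..k}. Max {norm (z j - xs), norm (x j - xs), norm (xt j - xs)})"

end

theory Submission
  imports Defs
begin

text \<open>
  Estimate-sequence argument. The functions \<open>\<psi>\<^sub>k\<close> are \<open>(1 + \<mu>\<^sub>\<tau> A\<^sub>k)\<close>-strongly convex, and the equation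
  defining \<open>\<alpha>\<^sub>k\<close> makes the growth of \<open>\<psi>\<^sub>k\<close> around its minimizer equal to the quadratic term of the
  smoothness upper bound at \<open>x\<^sub>k\<close>; hence \<open>A\<^sub>k f(x\<^sub>k) \<le> \<psi>\<^sub>k(z\<^sub>k)\<close> up to accumulated errors, while
  \<open>\<psi>\<^sub>k(z\<^sub>k) \<le> \<psi>\<^sub>k(x\<^sup>*) \<le> R\<^sup>2/2 + A\<^sub>k f(x\<^sup>*)\<close>, again up to errors. As \<open>L = 2 L\<^sub>f\<close>, half of the quadratic
  term absorbs the gradient error above at cost \<open>\<delta>\<^sub>2\<close>. Below, the gradient error is either bounded by
  \<open>\<delta>\<close> times the distances to \<open>x\<^sup>*\<close>, using, with \<open>y\<^sub>k\<close> the query points,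
  \<open>A\<^sub>k (x\<^sub>k\<^sub>-\<^sub>1 - y\<^sub>k) = \<alpha>\<^sub>k (x\<^sub>k\<^sub>-\<^sub>1 - z\<^sub>k\<^sub>-\<^sub>1)\<close>, or absorbed by half of the strong convexity
  at cost \<open>\<delta>\<^sub>3\<close>.
\<close>

section \<open>Convexity and smoothness inequalities\<close>

lemma norm_convex_combination_diff_sq:
  fixes a b p :: "'a::real_inner"
  shows "(norm ((1 - t) *\<^sub>R a + t *\<^sub>R b - p))\<^sup>2 =
    (1 - t) * (norm (a - p))\<^sup>2 + t * (norm (b - p))\<^sup>2 - t * (1 - t) * (norm (a - b))\<^sup>2"
  unfolding power2_norm_eq_inner
  by (simp add: algebra_simps inner_commute power2_eq_square)

text \<open>Minimality of \<open>z\<close> is tested against points of the segment towards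
  \<open>y\<close>: dividing by \<open>t\<close> leaves the factor \<open>1 - t\<close> on the
  quadratic term, and \<open>t\<close> tends to 0. In the proof \<open>s = 1 - t\<close>, so the
  limit is \<open>s\<close> tending to 1.\<close>

lemma strongly_convex_argmin_growth:
  fixes h :: "'a::real_inner \<Rightarrow> real"
  assumes "convex Q" and z: "is_arg_min h (\<lambda>x. x \<in> Q) z" and "y \<in> Q"
    and sc: "\<And>t. 0 < t \<Longrightarrow> t < 1 \<Longrightarrow>
      h ((1 - t) *\<^sub>R z + t *\<^sub>R y) + c / 2 * (t * (1 - t) * (norm (z - y))\<^sup>2) \<le> (1 - t) * h z + t * h y"
  shows "h z + c / 2 * (norm (z - y))\<^sup>2 \<le> h y"
proof -
  have "s * (c / 2 * (norm (z - y))\<^sup>2) \<le> h y - h z" if s: "0 < s" "s < 1" for s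
  proof -
    define t where "t = 1 - s"
    have t: "0 < t" "t < 1" using s by (auto simp: t_def)
    have "(1 - t) *\<^sub>R z + t *\<^sub>R y \<in> Q"
      using assms t by (intro convexD) (auto simp: is_arg_min_def)
    then have "h z \<le> h ((1 - t) *\<^sub>R z + t *\<^sub>R y)"
      using z by (auto simp: is_arg_min_linorder)
    with sc[OF t] have "t * (s * (c / 2 * (norm (z - y))\<^sup>2)) \<le> t * (h y - h z)"
      by (simp add: t_def algebra_simps diff_divide_distrib)
    with t show ?thesis by simp
  qed
  then have "c / 2 * (norm (z - y))\<^sup>2 \<le> h y - h z" by (rule field_le_mult_one_interval)
  then show ?thesis by simp
qed

text \<open>The function \<open>h\<close> below is \<open>l\<close> along the segment minus the
  linear and quadratic terms of the bound. Cauchy-Schwarz and the Lipschitz condition make its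
  derivative nonpositive.\<close>

lemma L_smooth_on_upper_bound:
  fixes l :: "'a::real_inner \<Rightarrow> real"
  assumes "convex Q" and sm: "L_smooth_on K Q l G" and x: "x \<in> Q" and y: "y \<in> Q"
  shows "l y \<le> l x + G x \<bullet> (y - x) + K / 2 * (norm (y - x))\<^sup>2"
proof -
  define d where "d = y - x"
  define h where "h t = l (x + t *\<^sub>R d) - t * (G x \<bullet> d) - K / 2 * t\<^sup>2 * (norm d)\<^sup>2" for t
  define h' where "h' t = (G (x + t *\<^sub>R d) - G x) \<bullet> d - K * t * (norm d)\<^sup>2" for t
  have Q: "x + t *\<^sub>R d \<in> Q" if "t \<in> {0..1}" for t
  proof -
    have "x + t *\<^sub>R d = (1 - t) *\<^sub>R x + t *\<^sub>R y" by (simp add: d_def algebra_simps)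
    then show ?thesis using that convexD[OF \<open>convex Q\<close> x y, of "1 - t" t] by simp
  qed
  have der: "(h has_real_derivative h' t) (at t within {0..1})" if "t \<in> {0..1}" for t
  proof -
    \<comment> \<open>The derivative of \<open>l\<close> is known only within \<open>Q\<close>; the
      chain rule wants it within the image of the segment, a subset of \<open>Q\<close>.\<close>
    have "(l has_derivative (\<lambda>e. G (x + t *\<^sub>R d) \<bullet> e)) (at (x + t *\<^sub>R d) within Q)"
      using sm Q[OF that] by (auto simp: L_smooth_on_def gradient_on_def)
    then have "(l has_derivative (\<lambda>e. G (x + t *\<^sub>R d) \<bullet> e))
        (at (x + t *\<^sub>R d) within (\<lambda>t. x + t *\<^sub>R d) ` {0..1})"
      by (rule has_derivative_subset) (use Q in auto)
    moreover have "((\<lambda>t. x + t *\<^sub>R d) has_derivative (\<lambda>e. e *\<^sub>R d)) (at t within {0..1})"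
      by (auto intro!: derivative_eq_intros)
    ultimately have "((\<lambda>t. l (x + t *\<^sub>R d)) has_derivative (\<lambda>e. G (x + t *\<^sub>R d) \<bullet> (e *\<^sub>R d)))
        (at t within {0..1})"
      using has_derivative_in_compose by blast
    then have l': "((\<lambda>t. l (x + t *\<^sub>R d)) has_real_derivative G (x + t *\<^sub>R d) \<bullet> d) (at t within {0..1})"
      by (simp add: has_field_derivative_def mult_commute_abs)
    show ?thesis unfolding h_def h'_def
      by (auto intro!: derivative_eq_intros l' simp: algebra_simps)
  qed
  have neg: "h' t \<le> 0" if t: "0 \<le> t" "t \<le> 1" for t
  proof -
    have "(G (x + t *\<^sub>R d) - G x) \<bullet> d \<le> norm (G (x + t *\<^sub>R d) - G x) * norm d"
      by (rule norm_cauchy_schwarz)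
    also have "norm (G (x + t *\<^sub>R d) - G x) \<le> K * norm (t *\<^sub>R d)"
      using sm Q[of t] x t by (force simp: L_smooth_on_def)
    finally show ?thesis using t by (simp add: h'_def power2_eq_square mult_right_mono algebra_simps)
  qed
  have "h 1 \<le> h 0"
  proof (rule DERIV_nonpos_imp_decreasing_open[of 0 1])
    show "\<exists>D. (h has_real_derivative D) (at t) \<and> D \<le> 0" if "0 < t" "t < 1" for t
      using der[of t] neg[of t] that at_within_Icc_at[of 0 t 1] by auto
    show "continuous_on {0..1} h"
      using der by (rule DERIV_continuous_on[where D = h'])
  qed simp
  then show ?thesis by (simp add: h_def d_def)
qed

text \<open>Adding the strong convexity inequalities with \<open>x\<close> and \<open>y\<close>
  exchanged cancels the values of \<open>l\<close> and leaves strong monotonicity of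
  \<open>G\<close>. Two distinct points are essential: on a singleton the two constants are
  unrelated.\<close>

lemma strongly_convex_le_smooth:
  fixes l :: "'a::real_inner \<Rightarrow> real"
  assumes "L_smooth_on K Q l G" "strongly_convex_on \<mu> Q l G" "x \<in> Q" "y \<in> Q" "x \<noteq> y"
  shows "\<mu> \<le> K"
proof -
  have "l x + G x \<bullet> (y - x) + \<mu> / 2 * (norm (x - y))\<^sup>2 \<le> l y"
    "l y + G y \<bullet> (x - y) + \<mu> / 2 * (norm (y - x))\<^sup>2 \<le> l x"
    using assms by (auto simp: strongly_convex_on_def)
  then have "\<mu> * (norm (x - y))\<^sup>2 \<le> (G x - G y) \<bullet> (x - y)"
    by (simp add: algebra_simps norm_minus_commute)
  also have "\<dots> \<le> norm (G x - G y) * norm (x - y)" by (rule norm_cauchy_schwarz)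
  also have "\<dots> \<le> K * norm (x - y) * norm (x - y)"
    using assms by (intro mult_right_mono) (auto simp: L_smooth_on_def)
  finally show ?thesis using assms by (simp add: power2_eq_square)
qed

lemma inexact_inner_bound:
  fixes g G e :: "'a::real_inner"
  assumes "norm (g - G) \<le> \<delta>"
  shows "\<bar>g \<bullet> e - G \<bullet> e\<bar> \<le> \<delta> * norm e"
proof -
  have "\<bar>(g - G) \<bullet> e\<bar> \<le> norm (g - G) * norm e" by (rule Cauchy_Schwarz_ineq2)
  also have "\<dots> \<le> \<delta> * norm e" using assms by (simp add: mult_right_mono)
  finally show ?thesis by (simp add: inner_diff_left)
qed

text \<open>The \<open>c / 4\<close> suits both uses: with \<open>c = L\<close> it is what
  smoothness with constant \<open>L / 2\<close> leaves of \<open>L / 2\<close>; with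
  \<open>c = \<mu>\<close>, taking it from \<open>\<mu> / 2\<close> leaves
  \<open>\<mu>\<^sub>2 / 2\<close>.\<close>

lemma young_ineq_scaled:
  fixes c \<delta> t :: real
  assumes "c > 0"
  shows "\<delta> * t \<le> c / 4 * t\<^sup>2 + \<delta>\<^sup>2 / c"
proof -
  have "0 \<le> (c * t / 2 - \<delta>)\<^sup>2 / c" using assms by simp
  also have "\<dots> = c / 4 * t\<^sup>2 + \<delta>\<^sup>2 / c - \<delta> * t"
    using assms by (simp add: field_simps power2_eq_square)
  finally show ?thesis by simp
qed

section \<open>The step size equation and the radius\<close>

lemma stm_step_root:
  assumes "L > 0" "m \<ge> 0" "a > 0"
  shows "stm_step L m a > 0" "(1 + m * a) * (a + stm_step L m a) = L * (stm_step L m a)\<^sup>2"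
proof -
  define p where "p = 1 + m * a"
  define w where "w = sqrt (p\<^sup>2 / (4 * L\<^sup>2) + a * p / L)"
  have p: "p > 0" using assms by (simp add: p_def add_pos_nonneg)
  have w2: "w\<^sup>2 = p\<^sup>2 / (4 * L\<^sup>2) + a * p / L" and w: "w \<ge> 0"
    using assms p by (auto simp: w_def)
  have st: "stm_step L m a = p / (2 * L) + w" by (simp add: stm_step_def p_def w_def)
  show "stm_step L m a > 0" using st w p assms by (simp add: add_pos_nonneg)
  have "L * (p / (2 * L) + w)\<^sup>2 = p\<^sup>2 / (4 * L) + p * w + L * w\<^sup>2"
    using assms by (simp add: power2_eq_square field_simps)
  also have "\<dots> = p * (a + (p / (2 * L) + w))"
    unfolding w2 using assms by (simp add: power2_eq_square field_simps)
  finally show "(1 + m * a) * (a + stm_step L m a) = L * (stm_step L m a)\<^sup>2"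
    unfolding st p_def[symmetric] by simp
qed

lemma stm_radius_ge:
  assumes "j \<le> k"
  shows "norm (z j - y) \<le> stm_radius y xt z x k" "norm (x j - y) \<le> stm_radius y xt z x k"
    "norm (xt j - y) \<le> stm_radius y xt z x k"
proof -
  have *: "Max {norm (z j - y), norm (x j - y), norm (xt j - y)} \<le> stm_radius y xt z x k"
    unfolding stm_radius_def using assms by (intro Max_ge) auto
  show "norm (z j - y) \<le> stm_radius y xt z x k" "norm (x j - y) \<le> stm_radius y xt z x k"
    "norm (xt j - y) \<le> stm_radius y xt z x k"
    by (rule order_trans[OF Max_ge *]; simp)+
qed

section \<open>Growth of the weights \<open>stm_A\<close>\<close>

context
  fixes L m :: real
  assumes L: "L > 0" and m: "m \<ge> 0"
begin

lemma stm_A_pos: "stm_A L m k > 0"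
  by (induction k) (use L m in \<open>auto intro: add_pos_pos stm_step_root\<close>)

lemma stm_alpha_pos: "stm_alpha L m k > 0"
  by (cases k) (use L m stm_A_pos in \<open>auto intro: stm_step_root\<close>)

lemma sum_stm_alpha: "(\<Sum>j\<le>k. stm_alpha L m j) = stm_A L m k"
  by (induction k) auto

lemma stm_A_Suc_root:
  "(1 + m * stm_A L m k) * stm_A L m (Suc k) = L * (stm_alpha L m (Suc k))\<^sup>2"
  using stm_step_root(2)[OF L m stm_A_pos] by simp

lemma stm_A_mono: "j \<le> k \<Longrightarrow> stm_A L m j \<le> stm_A L m k"
  by (rule lift_Suc_mono_le[of "stm_A L m"])
    (use stm_alpha_pos[of "Suc _"] in \<open>auto intro: less_imp_le\<close>)

text \<open>Discarding lower-order terms on the left of the step size equation leaves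
  \<open>m * A\<^sup>2 \<le> L * a\<^sup>2\<close> for the old weight \<open>A\<close> and the new
  step \<open>a\<close>.\<close>

lemma stm_A_Suc_ge: "(1 + sqrt (m / L)) * stm_A L m k \<le> stm_A L m (Suc k)"
proof -
  let ?A = "stm_A L m k" and ?a = "stm_alpha L m (Suc k)"
  have pos: "?A > 0" "?a > 0" by (rule stm_A_pos stm_alpha_pos)+
  have "m * ?A * ?A \<le> (1 + m * ?A) * stm_A L m (Suc k)"
    using pos m by (intro mult_mono) auto
  also have "\<dots> = L * ?a\<^sup>2" by (rule stm_A_Suc_root)
  finally have "(sqrt (m / L) * ?A)\<^sup>2 \<le> ?a\<^sup>2"
    using L m by (simp add: power2_eq_square field_simps)
  then have "sqrt (m / L) * ?A \<le> ?a"
    using pos by (meson less_imp_le power2_le_imp_le)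
  then show ?thesis by (simp add: algebra_simps)
qed

lemma stm_A_ge_power: "(1 + sqrt (m / L)) ^ k \<le> L * stm_A L m k"
proof (induction k)
  case 0
  then show ?case using L by simp
next
  case (Suc k)
  have "(1 + sqrt (m / L)) ^ Suc k \<le> (1 + sqrt (m / L)) * (L * stm_A L m k)"
    using Suc L m by (simp add: mult_left_mono)
  also have "\<dots> = L * ((1 + sqrt (m / L)) * stm_A L m k)" by simp
  also have "\<dots> \<le> L * stm_A L m (Suc k)"
    using stm_A_Suc_ge L by (intro mult_left_mono) auto
  finally show ?case .
qed

text \<open>The half in the exponent is the price of \<open>exp (s / 2) \<le> 1 + s\<close> for
  \<open>s = sqrt (m / L)\<close>, where \<open>m \<le> L\<close> keeps \<open>s\<close> at most 1.
  The form \<open>1 \<le> C * stm_A L m k\<close> is how \<open>stm_convergence\<close> takes a rate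
  \<open>C\<close>.\<close>

lemma stm_A_ge_exp:
  assumes "m \<le> L"
  shows "1 \<le> L * exp (- (1 / 2) * sqrt (m / L) * real k) * stm_A L m k"
proof -
  define s where "s = sqrt (m / L)"
  have s: "0 \<le> s" "s \<le> 1" using L m assms by (auto simp: s_def)
  have "exp (s / 2) \<le> 1 + s / 2 + (s / 2)\<^sup>2" using s by (intro exp_bound) auto
  also have "\<dots> \<le> 1 + s"
    using mult_left_mono[OF s(2) s(1)] s(1) unfolding power2_eq_square by linarith
  finally have "exp (s / 2) ^ k \<le> (1 + s) ^ k" by (intro power_mono) auto
  also have "exp (s / 2) ^ k = exp (1 / 2 * s * real k)"
    by (simp add: exp_of_nat_mult[symmetric] mult.commute)
  finally have "exp (1 / 2 * s * real k) \<le> L * stm_A L m k"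
    unfolding s_def using stm_A_ge_power order_trans by blast
  then show ?thesis unfolding s_def by (simp add: exp_minus field_simps)
qed

text \<open>Geometric growth keeps errors of weight \<open>stm_A L m j\<close> bounded after
  division by the last weight. The constant is the sum of the geometric series with ratio
  \<open>1 / (1 + sqrt (m / L))\<close>.\<close>

lemma sum_stm_A_le:
  assumes "m \<noteq> 0"
  shows "(\<Sum>j\<le>k. stm_A L m j) \<le> (1 + sqrt (L / m)) * stm_A L m k"
proof (induction k)
  case 0
  then show ?case using L m by (simp add: field_simps)
next
  case (Suc k)
  have *: "(1 + sqrt (L / m)) = sqrt (L / m) * (1 + sqrt (m / L))"
    using L m assms by (simp add: algebra_simps flip: real_sqrt_mult)
  have "(\<Sum>j\<le>Suc k. stm_A L m j) \<le> (1 + sqrt (L / m)) * stm_A L m k + stm_A L m (Suc k)"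
    using Suc by (simp only: sum.atMost_Suc add_right_mono)
  also have "(1 + sqrt (L / m)) * stm_A L m k \<le> sqrt (L / m) * stm_A L m (Suc k)"
    unfolding * mult.assoc using stm_A_Suc_ge L m by (intro mult_left_mono) auto
  finally show ?case by (simp only: distrib_right mult_1 add.commute)
qed

lemma stm_A_ge_square: "(real k + 2)\<^sup>2 \<le> 4 * L * stm_A L m k"
proof (induction k)
  case 0
  then show ?case using L by simp
next
  case (Suc k)
  let ?A = "stm_A L m k" and ?a = "stm_alpha L m (Suc k)"
  \<comment> \<open>In this scaling the step size equation yields
    \<open>(real k + 2)\<^sup>2 + 2 * b \<le> b\<^sup>2\<close>. Completing the square gives
    \<open>b \<ge> real k + 3\<close>, and \<open>4 * L * stm_A L m k\<close> grows by
    \<open>2 * b\<close>.\<close>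
  define b where "b = 2 * L * ?a"
  have pos: "?A > 0" "?a > 0" by (rule stm_A_pos stm_alpha_pos)+
  have "?A + ?a \<le> (1 + m * ?A) * stm_A L m (Suc k)"
    using pos m by (simp add: distrib_right)
  also have "\<dots> = L * ?a\<^sup>2" by (rule stm_A_Suc_root)
  finally have "4 * L * (?A + ?a) \<le> 4 * L * (L * ?a\<^sup>2)"
    using L by (intro mult_left_mono) auto
  with Suc have "(real k + 2)\<^sup>2 + 2 * b \<le> b\<^sup>2"
    by (simp add: b_def power2_eq_square algebra_simps)
  then have "(real k + 2)\<^sup>2 \<le> (b - 1)\<^sup>2" by (simp add: power2_eq_square algebra_simps)
  \<comment> \<open>Makes \<open>b - 1\<close> positive, so that square roots can be taken.\<close>
  moreover have "b \<ge> 2"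
  proof (rule ccontr)
    assume "\<not> b \<ge> 2"
    moreover have "b > 0" using L pos by (simp add: b_def)
    ultimately have "b * b \<le> 2 * b" by (intro mult_right_mono) auto
    with \<open>(real k + 2)\<^sup>2 + 2 * b \<le> b\<^sup>2\<close> have "(real k + 2)\<^sup>2 \<le> 0"
      by (simp add: power2_eq_square)
    then show False by simp
  qed
  ultimately have "real k + 3 \<le> b"
    using power2_le_imp_le[of "real k + 2" "b - 1"] by simp
  then show ?case using Suc
    by (simp add: b_def power2_eq_square algebra_simps)
qed

section \<open>Strong convexity of the estimate functions\<close>

lemma stm_psi_strongly_convex:
  assumes "convex_on Q r" "a \<in> Q" "b \<in> Q" and t: "0 \<le> t" "t \<le> 1"
  shows "stm_psi l g r L m xt k ((1 - t) *\<^sub>R a + t *\<^sub>R b)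
      + (1 + m * stm_A L m k) / 2 * (t * (1 - t) * (norm (a - b))\<^sup>2)
    \<le> (1 - t) * stm_psi l g r L m xt k a + t * stm_psi l g r L m xt k b"
proof -
  let ?c = "(1 - t) *\<^sub>R a + t *\<^sub>R b" and ?D = "t * (1 - t) * (norm (a - b))\<^sup>2"
  \<comment> \<open>The linear part is exact under convex combinations, \<open>r\<close> is convex,
    and the squared norm supplies the modulus \<open>m\<close>, here scaled by the weight.\<close>
  have model: "stm_alpha L m j * stm_model l g r m p ?c + m * stm_alpha L m j / 2 * ?D
      \<le> (1 - t) * (stm_alpha L m j * stm_model l g r m p a)
        + t * (stm_alpha L m j * stm_model l g r m p b)" for j p
  proof -
    have "r ?c \<le> (1 - t) * r a + t * r b"
      using assms by (auto simp: convex_on_def)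
    then have "stm_model l g r m p ?c + m / 2 * ?D
        \<le> (1 - t) * stm_model l g r m p a + t * stm_model l g r m p b"
      unfolding stm_model_def norm_convex_combination_diff_sq
      by (simp add: algebra_simps diff_divide_distrib add_divide_distrib)
    then have "stm_alpha L m j * (stm_model l g r m p ?c + m / 2 * ?D)
        \<le> stm_alpha L m j * ((1 - t) * stm_model l g r m p a + t * stm_model l g r m p b)"
      using stm_alpha_pos[of j] by simp
    then show ?thesis by (simp add: algebra_simps)
  qed
  show ?thesis
  proof (induction k)
    case 0
    \<comment> \<open>The initial squared distance supplies the 1 in the modulus; the models supply
      the rest.\<close>
    have "1 / 2 * (norm (?c - xt 0))\<^sup>2 + 1 / 2 * ?D
        = (1 - t) * (1 / 2 * (norm (a - xt 0))\<^sup>2) + t * (1 / 2 * (norm (b - xt 0))\<^sup>2)"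
      unfolding norm_convex_combination_diff_sq by (simp add: algebra_simps diff_divide_distrib)
    from add_mono[OF eq_refl[OF this] model[of 0 "xt 0"]] show ?case
      by (simp add: algebra_simps add_divide_distrib diff_divide_distrib)
  next
    case (Suc k)
    show ?case using add_mono[OF Suc model[of "Suc k" "xt (Suc k)"]]
      by (simp add: algebra_simps add_divide_distrib)
  qed
qed

section \<open>Bounds on the estimate functions along a run\<close>

context
  fixes Q :: "'a::real_inner set" and l r g x_start xt z x
  assumes Q: "convex Q" and r: "convex_on Q r"
    and run: "stm_run Q l g r L m x_start xt z x" and start: "x_start \<in> Q"
begin

lemma stm_z_in: "z k \<in> Q"
  using run by (auto simp: stm_run_def is_arg_min_def)

lemma stm_A_xt: "stm_A L m (Suc k) *\<^sub>R xt (Suc k) = stm_A L m k *\<^sub>R x k + stm_alpha L m (Suc k) *\<^sub>R z k"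
  using run stm_A_pos[of "Suc k"] by (simp add: stm_run_def)

lemma stm_A_x: "stm_A L m (Suc k) *\<^sub>R x (Suc k) = stm_A L m k *\<^sub>R x k + stm_alpha L m (Suc k) *\<^sub>R z (Suc k)"
  using run stm_A_pos[of "Suc k"] by (simp add: stm_run_def)

lemma stm_weighted_mean:
  assumes "A *\<^sub>R (p :: 'a) = B *\<^sub>R u + b *\<^sub>R v" "A = B + b" "B > 0" "b > 0"
  shows "p = (B / A) *\<^sub>R u + (b / A) *\<^sub>R v" "B / A \<ge> 0" "b / A \<ge> 0" "B / A + b / A = 1"
proof -
  have "p = inverse A *\<^sub>R (A *\<^sub>R p)" using assms(2-) by simp
  then show "p = (B / A) *\<^sub>R u + (b / A) *\<^sub>R v"
    unfolding assms(1) by (simp add: algebra_simps divide_inverse)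
qed (use assms(2-) in \<open>auto simp flip: add_divide_distrib\<close>)

lemmas stm_x_mean =
  stm_weighted_mean[OF stm_A_x stm_A.simps(2)[of L m, folded stm_alpha.simps(2)] stm_A_pos stm_alpha_pos]
lemmas stm_xt_mean =
  stm_weighted_mean[OF stm_A_xt stm_A.simps(2)[of L m, folded stm_alpha.simps(2)] stm_A_pos stm_alpha_pos]

lemma stm_x_in: "x k \<in> Q"
proof (induction k)
  case 0
  then show ?case using run stm_z_in[of 0] by (simp add: stm_run_def)
next
  case (Suc k)
  then show ?case using convexD[OF Q Suc stm_z_in stm_x_mean(2-4)] stm_x_mean(1) by metis
qed

lemma stm_xt_in: "xt k \<in> Q"
proof (cases k)
  case 0
  then show ?thesis using run start by (simp add: stm_run_def)
next
  case (Suc j)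
  then show ?thesis using convexD[OF Q stm_x_in stm_z_in stm_xt_mean(2-4)] stm_xt_mean(1) by metis
qed

text \<open>The errors stay abstract so that all three estimates can share the induction:
  \<open>u\<close> belongs to the upper bound at \<open>x k\<close>, \<open>v\<close> to the lower
  bound at the previous \<open>x\<close>. The weight of \<open>v j\<close> is the previous
  \<open>stm_A\<close>, and 0 at \<open>j = 0\<close>.\<close>

lemma stm_estimate_lower:
  fixes u v :: "nat \<Rightarrow> real"
  assumes u: "\<And>k. l (x k) \<le> l (xt k) + g (xt k) \<bullet> (x k - xt k) + L / 2 * (norm (x k - xt k))\<^sup>2 + u k"
    and v: "\<And>k. l (xt (Suc k)) + g (xt (Suc k)) \<bullet> (x k - xt (Suc k)) \<le> l (x k) + v (Suc k)"
  shows "stm_A L m k * (l (x k) + r (x k)) \<le> stm_psi l g r L m xt k (z k)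
    + (\<Sum>j\<le>k. stm_A L m j * u j + (stm_A L m j - stm_alpha L m j) * v j)"
proof (induction k)
  case 0
  \<comment> \<open>As \<open>x 0 = z 0\<close> and the first weight is \<open>1 / L\<close>, the
    initial squared distance is exactly the weighted quadratic term of the upper bound.\<close>
  have "m / 2 * (norm (x 0 - xt 0))\<^sup>2 \<ge> 0" using m by simp
  with u[of 0] have "l (x 0) + r (x 0) \<le> L / 2 * (norm (x 0 - xt 0))\<^sup>2 + stm_model l g r m (xt 0) (x 0) + u 0"
    unfolding stm_model_def by linarith
  then have "1 / L * (l (x 0) + r (x 0)) \<le> 1 / L * (L / 2 * (norm (x 0 - xt 0))\<^sup>2 + stm_model l g r m (xt 0) (x 0) + u 0)"
    using L by (intro mult_left_mono) auto
  then show ?case using run L by (simp add: stm_run_def distrib_left)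
next
  case (Suc k)
  let ?A = "stm_A L m k" and ?B = "stm_A L m (Suc k)" and ?a = "stm_alpha L m (Suc k)"
  let ?x = "x (Suc k)" and ?y = "xt (Suc k)" and ?z = "z (Suc k)"
  have pos: "?A > 0" "?a > 0" "?B > 0" by (rule stm_A_pos stm_alpha_pos)+
  have B: "?B = ?A + ?a" by simp
  have grow: "stm_psi l g r L m xt k (z k) + (1 + m * ?A) / 2 * (norm (z k - ?z))\<^sup>2
      \<le> stm_psi l g r L m xt k ?z"
  proof (rule strongly_convex_argmin_growth[OF Q])
    show "is_arg_min (stm_psi l g r L m xt k) (\<lambda>y. y \<in> Q) (z k)"
      using run by (simp add: stm_run_def)
    show "stm_psi l g r L m xt k ((1 - t) *\<^sub>R z k + t *\<^sub>R ?z)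
        + (1 + m * ?A) / 2 * (t * (1 - t) * (norm (z k - ?z))\<^sup>2)
      \<le> (1 - t) * stm_psi l g r L m xt k (z k) + t * stm_psi l g r L m xt k ?z"
      if "0 < t" "t < 1" for t
      using that by (intro stm_psi_strongly_convex[OF r stm_z_in stm_z_in]) auto
  qed (rule stm_z_in)
  \<comment> \<open>The updates of \<open>x\<close> and \<open>xt\<close> differ only in which
    \<open>z\<close> they use.\<close>
  have diff: "?B *\<^sub>R (?x - ?y) = ?a *\<^sub>R (?z - z k)"
    by (simp only: scaleR_diff_right stm_A_x stm_A_xt) simp
  have quad: "(1 + m * ?A) / 2 * (norm (z k - ?z))\<^sup>2 = ?B * (L / 2 * (norm (?x - ?y))\<^sup>2)"
  proof -
    have "?B * norm (?x - ?y) = ?a * norm (z k - ?z)"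
      using arg_cong[OF diff, of norm] pos by (simp add: norm_minus_commute)
    then have "?B\<^sup>2 * (norm (?x - ?y))\<^sup>2 = ?a\<^sup>2 * (norm (z k - ?z))\<^sup>2"
      by (metis power_mult_distrib)
    then have "L * (?B\<^sup>2 * (norm (?x - ?y))\<^sup>2) = (L * ?a\<^sup>2) * (norm (z k - ?z))\<^sup>2" by simp
    also have "\<dots> = ?B * ((1 + m * ?A) * (norm (z k - ?z))\<^sup>2)"
      unfolding stm_A_Suc_root[symmetric] by (simp only: mult_ac)
    finally have "?B * (?B * (L * (norm (?x - ?y))\<^sup>2)) = ?B * ((1 + m * ?A) * (norm (z k - ?z))\<^sup>2)"
      by (simp only: power2_eq_square mult_ac)
    then have "?B * (L * (norm (?x - ?y))\<^sup>2) = (1 + m * ?A) * (norm (z k - ?z))\<^sup>2"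
      using pos(3) by (metis mult_cancel_left less_irrefl)
    then show ?thesis by simp
  qed
  have rx: "?B * r ?x \<le> ?A * r (x k) + ?a * r ?z"
  proof -
    have "r ?x \<le> ?A / ?B * r (x k) + ?a / ?B * r ?z"
      using r stm_x_in[of k] stm_z_in[of "Suc k"] stm_x_mean(2-4)[of k]
      unfolding stm_x_mean(1)[of k] convex_on_def by blast
    then have "?B * r ?x \<le> ?B * (?A / ?B * r (x k) + ?a / ?B * r ?z)"
      using pos by (intro mult_left_mono) auto
    also have "\<dots> = ?A * r (x k) + ?a * r ?z"
      using pos(3) by (simp add: distrib_left del: stm_A.simps stm_alpha.simps)
    finally show ?thesis .
  qed
  \<comment> \<open>Merges the linearization at the old \<open>x k\<close> with the linear part of
    the new model at \<open>?z\<close> into the linearization at \<open>?x\<close>.\<close>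
  have gx: "?A * (g ?y \<bullet> (x k - ?y)) + ?a * (g ?y \<bullet> (?z - ?y)) = ?B * (g ?y \<bullet> (?x - ?y))"
  proof -
    have "?A *\<^sub>R (x k - ?y) + ?a *\<^sub>R (?z - ?y) 
        = (?A *\<^sub>R x k + ?a *\<^sub>R ?z) - (?A + ?a) *\<^sub>R ?y"
      by (simp only: scaleR_diff_right scaleR_add_left) simp
    also have "\<dots> = ?B *\<^sub>R ?x - ?B *\<^sub>R ?y"
      by (simp only: stm_A_x B[symmetric])
    finally have "g ?y \<bullet> (?A *\<^sub>R (x k - ?y) + ?a *\<^sub>R (?z - ?y)) = g ?y \<bullet> (?B *\<^sub>R (?x - ?y))"
      by (simp only: scaleR_diff_right)
    then show ?thesis by (simp only: inner_add_right inner_scaleR_right)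
  qed
  have 1: "?A * (l ?y + g ?y \<bullet> (x k - ?y)) \<le> ?A * (l (x k) + v (Suc k))"
    using v pos by (intro mult_left_mono) auto
  have 2: "?B * l ?x \<le> ?B * (l ?y + g ?y \<bullet> (?x - ?y) + L / 2 * (norm (?x - ?y))\<^sup>2 + u (Suc k))"
    using u pos by (intro mult_left_mono) auto
  have 3: "?a * (l ?y + g ?y \<bullet> (?z - ?y) + r ?z) \<le> ?a * stm_model l g r m ?y ?z"
    using pos m by (intro mult_left_mono) (auto simp: stm_model_def)
  have l: "?B * l ?y = ?A * l ?y + ?a * l ?y" unfolding B by (rule distrib_right)
  have psi: "stm_psi l g r L m xt (Suc k) ?z = stm_psi l g r L m xt k ?z + ?a * stm_model l g r m ?y ?z"
    by simp
  have Aa: "(?B - ?a) * v (Suc k) = ?A * v (Suc k)" by simp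
  show ?case
    using Suc grow[unfolded quad] rx gx 1 2 3 l
    unfolding psi sum.atMost_Suc Aa distrib_left by linarith
qed

lemma stm_psi_upper:
  fixes w :: "nat \<Rightarrow> real"
  assumes w: "\<And>k. l (xt k) + g (xt k) \<bullet> (y - xt k) + m / 2 * (norm (y - xt k))\<^sup>2 \<le> l y + w k"
  shows "stm_psi l g r L m xt k y \<le> (norm (x_start - y))\<^sup>2 / 2 + stm_A L m k * (l y + r y)
    + (\<Sum>j\<le>k. stm_alpha L m j * w j)"
proof -
  have step: "stm_alpha L m j * stm_model l g r m (xt j) y
      \<le> stm_alpha L m j * (l y + r y) + stm_alpha L m j * w j" for j
  proof -
    have "stm_model l g r m (xt j) y \<le> (l y + r y) + w j"
      using w[of j] by (simp add: stm_model_def)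
    then show ?thesis unfolding distrib_left[symmetric]
      using stm_alpha_pos[of j] by (intro mult_left_mono) auto
  qed
  show ?thesis
  proof (induction k)
    case 0
    then show ?case using step[of 0] run by (simp add: stm_run_def norm_minus_commute)
  next
    case (Suc k)
    then show ?case using step[of "Suc k"] by (simp add: distrib_right)
  qed
qed

text \<open>Both bounds on the estimate function meet at \<open>y\<close>, and division by
  \<open>stm_A L m k\<close> gives the rate. The condition on \<open>C\<close> turns the initial
  distance term into \<open>C * R\<^sup>2\<close>, with a factor 2 to spare.\<close>

lemma stm_convergence:
  fixes u v w :: "nat \<Rightarrow> real"
  assumes "\<And>k. l (x k) \<le> l (xt k) + g (xt k) \<bullet> (x k - xt k) + L / 2 * (norm (x k - xt k))\<^sup>2 + u k"
    and "\<And>k. l (xt (Suc k)) + g (xt (Suc k)) \<bullet> (x k - xt (Suc k)) \<le> l (x k) + v (Suc k)"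
    and "\<And>k. l (xt k) + g (xt k) \<bullet> (y - xt k) + m / 2 * (norm (y - xt k))\<^sup>2 \<le> l y + w k"
    and "y \<in> Q" and "norm (x_start - y) \<le> R"
    and err: "(\<Sum>j\<le>k. stm_A L m j * u j + (stm_A L m j - stm_alpha L m j) * v j + stm_alpha L m j * w j)
      \<le> stm_A L m k * e"
    and C: "1 \<le> C * stm_A L m k"
  shows "l (x k) + r (x k) - (l y + r y) \<le> C * R\<^sup>2 + e"
proof -
  have A: "stm_A L m k > 0" by (rule stm_A_pos)
  have "stm_psi l g r L m xt k (z k) \<le> stm_psi l g r L m xt k y"
    using run \<open>y \<in> Q\<close> by (auto simp: stm_run_def is_arg_min_linorder)
  with stm_estimate_lower[OF assms(1,2), of k] stm_psi_upper[OF assms(3), of k] err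
  have "stm_A L m k * (l (x k) + r (x k)) \<le> (norm (x_start - y))\<^sup>2 / 2 + stm_A L m k * (l y + r y) + stm_A L m k * e"
    by (simp add: sum.distrib)
  moreover have "(norm (x_start - y))\<^sup>2 \<le> R\<^sup>2" using assms(5) by (intro power_mono) auto
  moreover have "R\<^sup>2 \<le> (C * stm_A L m k) * R\<^sup>2" using mult_right_mono[OF C, of "R\<^sup>2"] by simp
  moreover have "R\<^sup>2 \<ge> 0" by simp
  ultimately have "stm_A L m k * (l (x k) + r (x k)) \<le> stm_A L m k * (l y + r y + C * R\<^sup>2 + e)"
    by (simp only: distrib_left mult_ac)
  with A show ?thesis by simp
qed

text \<open>For \<open>j > 0\<close> the identity for the query point and the triangle inequality
  through \<open>y\<close> bound the first term by two radii, and the second adds one. At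
  \<open>j = 0\<close> the first weight vanishes, leaving a single radius.\<close>

lemma stm_gradient_error:
  assumes \<delta>: "\<delta> \<ge> 0" and j: "j \<le> k"
  shows "(stm_A L m j - stm_alpha L m j) * (\<delta> * norm (x (j - 1) - xt j))
      + stm_alpha L m j * (\<delta> * norm (y - xt j))
    \<le> stm_alpha L m j * (of_bool (j = 0) + 3 * of_bool (j \<noteq> 0)) * stm_radius y xt z x k * \<delta>"
proof -
  let ?R = "stm_radius y xt z x k"
  have w: "stm_alpha L m j * (\<delta> * norm (y - xt j)) \<le> stm_alpha L m j * (\<delta> * ?R)"
    using stm_radius_ge(3)[OF j, of xt y z x] \<delta> stm_alpha_pos[of j]
    by (intro mult_left_mono) (auto simp: norm_minus_commute)
  show ?thesis
  proof (cases j)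
    case 0
    then show ?thesis using w by (simp add: mult_ac)
  next
    case (Suc i)
    let ?A = "stm_A L m i" and ?B = "stm_A L m j" and ?a = "stm_alpha L m j"
    have B: "?B = ?A + ?a" using Suc by simp
    have pos: "?A > 0" "?a > 0" "?B > 0" by (rule stm_A_pos stm_alpha_pos)+
    have "?B *\<^sub>R (x i - xt j) = ?a *\<^sub>R (x i - z i)"
      using stm_A_xt[of i] B Suc by (simp add: algebra_simps)
    then have "?B * norm (x i - xt j) = ?a * norm (x i - z i)"
      using pos by (metis abs_of_pos norm_scaleR)
    also have "norm (x i - z i) \<le> 2 * ?R"
      using norm_triangle_ineq4[of "x i - y" "z i - y"] stm_radius_ge(1)[of i k z y xt x]
          stm_radius_ge(2)[of i k x y xt z] j Suc by simp
    finally have "?B * norm (x i - xt j) \<le> ?a * (2 * ?R)" using pos by simp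
    moreover have "?A * norm (x i - xt j) \<le> ?B * norm (x i - xt j)"
      using pos B by (intro mult_right_mono) auto
    ultimately have "\<delta> * (?A * norm (x i - xt j)) \<le> \<delta> * (?a * (2 * ?R))"
      using \<delta> by (intro mult_left_mono) auto
    then show ?thesis using w Suc by (simp add: algebra_simps)
  qed
qed

end

end

section \<open>Convergence rates with and without strong convexity\<close>

theorem theorem6p6:
  fixes Q :: "(real ^ 'n) set"
    and \<L> r f :: "real ^ 'n \<Rightarrow> real"
    and grad_\<L> inexact_grad_\<L> :: "real ^ 'n \<Rightarrow> real ^ 'n"
    and x_start x_star :: "real ^ 'n"
    and L\<^sub>f L \<mu> \<mu>\<^sub>1 \<mu>\<^sub>2 \<delta> \<delta>\<^sub>1 \<delta>\<^sub>2 \<delta>\<^sub>3 R :: real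
  assumes "closed Q" and "convex Q"
    and "L\<^sub>f > 0" and "L_smooth_on L\<^sub>f Q \<L> grad_\<L>"
    and "\<mu> \<ge> 0" and "strongly_convex_on \<mu> Q \<L> grad_\<L>"
    and "convex_on Q r"
    and "f = (\<lambda>x. \<L> x + r x)"
    and "\<And>x. x \<in> Q \<Longrightarrow> norm (inexact_grad_\<L> x - grad_\<L> x) \<le> \<delta>"
    and "x_start \<in> Q"
    and "is_arg_min f (\<lambda>x. x \<in> Q) x_star"
    and "is_arg_min (\<lambda>x. norm (x - x_start)) (is_arg_min f (\<lambda>x. x \<in> Q)) x_star"
    and "norm (x_start - x_star) \<le> R"
    and "L = 2 * L\<^sub>f"
    and "\<mu>\<^sub>1 = \<mu>" and "\<mu>\<^sub>2 = \<mu> / 2"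
    and "\<delta>\<^sub>1 = \<delta>" and "\<delta>\<^sub>2 = \<delta>\<^sup>2 / L" and "\<mu> \<noteq> 0 \<Longrightarrow> \<delta>\<^sub>3 = \<delta>\<^sup>2 / \<mu>"
  shows
    "(\<mu> \<noteq> 0 \<longrightarrow>
       (\<forall>xt z x. stm_run Q \<L> inexact_grad_\<L> r L \<mu>\<^sub>1 x_start xt z x \<longrightarrow>
         (\<forall>N\<ge>0. f (x N) - f x_star \<le>
            L * R\<^sup>2 * exp (- (1 / 2) * sqrt (\<mu>\<^sub>1 / L) * real N)
            + (1 + sqrt (L / \<mu>\<^sub>1)) * \<delta>\<^sub>2
            + 3 * stm_radius x_star xt z x N * \<delta>\<^sub>1)) \<and>
       (\<forall>xt z x. stm_run Q \<L> inexact_grad_\<L> r L \<mu>\<^sub>2 x_start xt z x \<longrightarrow>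
         (\<forall>N\<ge>0. f (x N) - f x_star \<le>
            L * R\<^sup>2 * exp (- (1 / 2) * sqrt (\<mu>\<^sub>2 / L) * real N)
            + (1 + sqrt (L / \<mu>\<^sub>2)) * \<delta>\<^sub>2
            + (1 + sqrt (L / \<mu>\<^sub>2)) * \<delta>\<^sub>3))) \<and>
     (\<mu> = 0 \<longrightarrow>
       (\<forall>xt z x. stm_run Q \<L> inexact_grad_\<L> r L 0 x_start xt z x \<longrightarrow>
         (\<forall>N\<ge>1. f (x N) - f x_star \<le>
            4 * L * R\<^sup>2 / (real N)\<^sup>2
            + 3 * stm_radius x_star xt z x N * \<delta>\<^sub>1
            + real N * \<delta>\<^sub>2)))"
proof -
  have Q: "convex Q" and smooth: "L_smooth_on L\<^sub>f Q \<L> grad_\<L>"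
    and sc: "strongly_convex_on \<mu> Q \<L> grad_\<L>" and r: "convex_on Q r"
    and f: "f = (\<lambda>x. \<L> x + r x)" and start: "x_start \<in> Q"
    and R: "norm (x_start - x_star) \<le> R" and \<mu>: "\<mu> \<ge> 0"
    and L: "L > 0" and \<delta>\<^sub>2: "\<delta>\<^sub>2 = \<delta>\<^sup>2 / L"
    using assms by auto
  have star: "x_star \<in> Q" using assms by (auto simp: is_arg_min_def)
  have err: "norm (inexact_grad_\<L> p - grad_\<L> p) \<le> \<delta>" if "p \<in> Q" for p
    using assms that by blast
  have \<delta>: "\<delta> \<ge> 0" using err[OF start] norm_ge_zero order_trans by blast
  let ?g = inexact_grad_\<L>
  have \<mu>L: "\<mu> \<le> L" if "p \<in> Q" "p \<noteq> x_star" for p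
    using strongly_convex_le_smooth[OF smooth sc that(1) star that(2)] assms by simp
  \<comment> \<open>Smoothness uses only \<open>L\<^sub>f / 2 = L / 4\<close>; the remaining quarter
    pays for the gradient error in \<open>upper\<close>.\<close>
  have upper': "\<L> q \<le> \<L> p + ?g p \<bullet> (q - p) + L / 4 * (norm (q - p))\<^sup>2 + \<delta> * norm (q - p)"
    if "p \<in> Q" "q \<in> Q" for p q
    using L_smooth_on_upper_bound[OF Q smooth that] inexact_inner_bound[OF err[OF that(1)], of "q - p"]
    by (simp add: \<open>L = 2 * L\<^sub>f\<close>)
  have upper: "\<L> q \<le> \<L> p + ?g p \<bullet> (q - p) + L / 2 * (norm (q - p))\<^sup>2 + \<delta>\<^sub>2"
    if "p \<in> Q" "q \<in> Q" for p q
    using upper'[OF that] young_ineq_scaled[OF L, of \<delta> "norm (q - p)"] by (simp add: \<delta>\<^sub>2)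
  have lower: "\<L> p + ?g p \<bullet> (q - p) + \<mu> / 2 * (norm (q - p))\<^sup>2 \<le> \<L> q + \<delta> * norm (q - p)"
    if "p \<in> Q" "q \<in> Q" for p q
    using sc that inexact_inner_bound[OF err[OF that(1)], of "q - p"]
    by (force simp: strongly_convex_on_def norm_minus_commute)
  have lower0: "\<L> p + ?g p \<bullet> (q - p) \<le> \<L> q + \<delta> * norm (q - p)" if "p \<in> Q" "q \<in> Q" for p q
    using lower[OF that] \<mu> by (smt (verit) divide_nonneg_nonneg mult_nonneg_nonneg zero_le_power2)

  have strong1: "f (x N) - f x_star \<le> L * R\<^sup>2 * exp (- (1 / 2) * sqrt (\<mu> / L) * real N)
      + (1 + sqrt (L / \<mu>)) * \<delta>\<^sub>2 + 3 * stm_radius x_star xt z x N * \<delta>"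
    if "\<mu> \<noteq> 0" and run: "stm_run Q \<L> ?g r L \<mu> x_start xt z x" for xt z x N
  proof -
    note in_Q = stm_xt_in[OF L \<mu> Q r run start] stm_x_in[OF L \<mu> Q r run start]
    note apos = stm_alpha_pos[OF L \<mu>]
    let ?A = "stm_A L \<mu>" and ?a = "stm_alpha L \<mu>" and ?R = "stm_radius x_star xt z x N"
    have R0: "?R \<ge> 0" using stm_radius_ge(1)[of 0 N z x_star xt x] norm_ge_zero order_trans by blast
    show ?thesis
    \<comment> \<open>At the solution the left side is 0 and the right side nonnegative; otherwise
      \<open>Q\<close> has two distinct points, which gives \<open>\<mu> \<le> L\<close>.\<close>
    proof (cases "x N = x_star")
      case True
      then show ?thesis using L \<mu> \<delta> R0 by (simp add: \<delta>\<^sub>2)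
    next
      case False
      have "(\<Sum>j\<le>N. ?A j * \<delta>\<^sub>2 + (?A j - ?a j) * (\<delta> * norm (x (j - 1) - xt j))
          + ?a j * (\<delta> * norm (x_star - xt j))) \<le> (\<Sum>j\<le>N. ?A j * \<delta>\<^sub>2 + ?a j * (3 * ?R * \<delta>))"
      proof (rule sum_mono)
        fix j assume "j \<in> {..N}"
        then have "(?A j - ?a j) * (\<delta> * norm (x (j - 1) - xt j)) + ?a j * (\<delta> * norm (x_star - xt j))
            \<le> ?a j * (of_bool (j = 0) + 3 * of_bool (j \<noteq> 0)) * ?R * \<delta>"
          by (intro stm_gradient_error[OF L \<mu> Q r run start \<delta>]) auto
        also have "\<dots> \<le> ?a j * (3 * ?R * \<delta>)"
          using R0 \<delta> apos[of j] by (simp add: mult_right_mono)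
        finally show "?A j * \<delta>\<^sub>2 + (?A j - ?a j) * (\<delta> * norm (x (j - 1) - xt j))
          + ?a j * (\<delta> * norm (x_star - xt j)) \<le> ?A j * \<delta>\<^sub>2 + ?a j * (3 * ?R * \<delta>)"
          by simp
      qed
      also have "\<dots> = (\<Sum>j\<le>N. ?A j) * \<delta>\<^sub>2 + ?A N * (3 * ?R * \<delta>)"
        by (simp only: sum.distrib sum_distrib_right[symmetric] sum_stm_alpha[OF L \<mu>])
      also have "(\<Sum>j\<le>N. ?A j) * \<delta>\<^sub>2 \<le> ((1 + sqrt (L / \<mu>)) * ?A N) * \<delta>\<^sub>2"
        using sum_stm_A_le[OF L \<mu> \<open>\<mu> \<noteq> 0\<close>] L by (intro mult_right_mono) (auto simp: \<delta>\<^sub>2)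
      finally have errs: "(\<Sum>j\<le>N. ?A j * \<delta>\<^sub>2 + (?A j - ?a j) * (\<delta> * norm (x (j - 1) - xt j))
          + ?a j * (\<delta> * norm (x_star - xt j))) \<le> ?A N * ((1 + sqrt (L / \<mu>)) * \<delta>\<^sub>2 + 3 * ?R * \<delta>)"
        by (simp add: algebra_simps)
      have C: "1 \<le> L * exp (- (1 / 2) * sqrt (\<mu> / L) * real N) * ?A N"
        by (rule stm_A_ge_exp[OF L \<mu> \<mu>L[OF in_Q(2) False]])
      have "\<L> (x N) + r (x N) - (\<L> x_star + r x_star)
          \<le> L * exp (- (1 / 2) * sqrt (\<mu> / L) * real N) * R\<^sup>2
            + ((1 + sqrt (L / \<mu>)) * \<delta>\<^sub>2 + 3 * ?R * \<delta>)"
        by (rule stm_convergence[OF L \<mu> Q r run start _ _ _ star R errs C])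
          (rule upper lower in_Q star | simp add: lower0 in_Q)+
      then show ?thesis by (simp add: f mult_ac)
    qed
  qed

  have strong2: "f (x N) - f x_star \<le> L * R\<^sup>2 * exp (- (1 / 2) * sqrt (\<mu>\<^sub>2 / L) * real N)
      + (1 + sqrt (L / \<mu>\<^sub>2)) * \<delta>\<^sub>2 + (1 + sqrt (L / \<mu>\<^sub>2)) * \<delta>\<^sub>3"
    if "\<mu> \<noteq> 0" and run: "stm_run Q \<L> ?g r L \<mu>\<^sub>2 x_start xt z x" for xt z x N
  proof -
    have \<mu>\<^sub>2: "\<mu>\<^sub>2 \<ge> 0" "\<mu>\<^sub>2 \<noteq> 0" "\<mu>\<^sub>2 = \<mu> / 2" and \<delta>\<^sub>3: "\<delta>\<^sub>3 = \<delta>\<^sup>2 / \<mu>" using \<mu> that assms by auto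
    note in_Q = stm_xt_in[OF L \<mu>\<^sub>2(1) Q r run start] stm_x_in[OF L \<mu>\<^sub>2(1) Q r run start]
    let ?A = "stm_A L \<mu>\<^sub>2" and ?a = "stm_alpha L \<mu>\<^sub>2"
    \<comment> \<open>Half of the strong convexity absorbs the gradient error, so no distance
      remains on the right.\<close>
    have lower2: "\<L> p + ?g p \<bullet> (q - p) + \<mu>\<^sub>2 / 2 * (norm (q - p))\<^sup>2 \<le> \<L> q + \<delta>\<^sub>3"
      if "p \<in> Q" "q \<in> Q" for p q
      using lower[OF that] young_ineq_scaled[of \<mu> \<delta> "norm (q - p)"] \<mu> \<open>\<mu> \<noteq> 0\<close>
      by (simp add: \<mu>\<^sub>2(3) \<delta>\<^sub>3)
    have lower20: "\<L> p + ?g p \<bullet> (q - p) \<le> \<L> q + \<delta>\<^sub>3" if "p \<in> Q" "q \<in> Q" for p q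
      using lower2[OF that] \<mu>\<^sub>2(1) by (smt (verit) divide_nonneg_nonneg mult_nonneg_nonneg zero_le_power2)
    show ?thesis
    proof (cases "x N = x_star")
      case True
      then show ?thesis using L \<mu> \<mu>\<^sub>2 by (simp add: \<delta>\<^sub>2 \<delta>\<^sub>3)
    next
      case False
      \<comment> \<open>With both lower-bound errors equal to \<open>\<delta>\<^sub>3\<close>, their
        weights add up to \<open>?A j\<close>, hence the same factor as for
        \<open>\<delta>\<^sub>2\<close>.\<close>
      have "(\<Sum>j\<le>N. ?A j * \<delta>\<^sub>2 + (?A j - ?a j) * \<delta>\<^sub>3 + ?a j * \<delta>\<^sub>3) = (\<Sum>j\<le>N. ?A j) * (\<delta>\<^sub>2 + \<delta>\<^sub>3)"
        unfolding sum_distrib_right by (rule sum.cong) (auto simp: algebra_simps)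
      also have "\<dots> \<le> ((1 + sqrt (L / \<mu>\<^sub>2)) * ?A N) * (\<delta>\<^sub>2 + \<delta>\<^sub>3)"
        using sum_stm_A_le[OF L \<mu>\<^sub>2(1,2)] L \<mu> by (intro mult_right_mono) (auto simp: \<delta>\<^sub>2 \<delta>\<^sub>3)
      finally have errs: "(\<Sum>j\<le>N. ?A j * \<delta>\<^sub>2 + (?A j - ?a j) * \<delta>\<^sub>3 + ?a j * \<delta>\<^sub>3)
          \<le> ?A N * ((1 + sqrt (L / \<mu>\<^sub>2)) * \<delta>\<^sub>2 + (1 + sqrt (L / \<mu>\<^sub>2)) * \<delta>\<^sub>3)"
        by (simp add: algebra_simps)
      have "\<mu>\<^sub>2 \<le> L" using \<mu>L[OF in_Q(2) False] \<mu> \<mu>\<^sub>2(3) by simp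
      then have C: "1 \<le> L * exp (- (1 / 2) * sqrt (\<mu>\<^sub>2 / L) * real N) * ?A N"
        by (rule stm_A_ge_exp[OF L \<mu>\<^sub>2(1)])
      have "\<L> (x N) + r (x N) - (\<L> x_star + r x_star)
          \<le> L * exp (- (1 / 2) * sqrt (\<mu>\<^sub>2 / L) * real N) * R\<^sup>2
            + ((1 + sqrt (L / \<mu>\<^sub>2)) * \<delta>\<^sub>2 + (1 + sqrt (L / \<mu>\<^sub>2)) * \<delta>\<^sub>3)"
        by (rule stm_convergence[OF L \<mu>\<^sub>2(1) Q r run start _ _ _ star R errs C])
          (rule upper lower2 lower20 in_Q star)+
      then show ?thesis by (simp add: f mult_ac)
    qed
  qed

  have weak: "f (x N) - f x_star \<le> 4 * L * R\<^sup>2 / (real N)\<^sup>2 + 3 * stm_radius x_star xt z x N * \<delta> + real N * \<delta>\<^sub>2"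
    if "\<mu> = 0" and run: "stm_run Q \<L> ?g r L 0 x_start xt z x" and "N \<ge> 1" for xt z x N
  proof -
    note in_Q = stm_xt_in[OF L order_refl Q r run start] stm_x_in[OF L order_refl Q r run start]
    let ?A = "stm_A L 0" and ?a = "stm_alpha L 0" and ?R = "stm_radius x_star xt z x N"
    let ?v = "\<lambda>j. \<delta> * norm (x (j - 1) - xt j)" and ?w = "\<lambda>j. \<delta> * norm (x_star - xt j)"
    \<comment> \<open>Charging step 0 to the radius instead of \<open>\<delta>\<^sub>2\<close> leaves only \<open>N\<close> of the \<open>N + 1\<close> terms \<open>\<delta>\<^sub>2\<close>.\<close>
    define u where "u j = (if j = 0 then \<delta> * norm (x j - xt j) else \<delta>\<^sub>2)" for j
    have upper_u: "\<L> (x k) \<le> \<L> (xt k) + ?g (xt k) \<bullet> (x k - xt k) + L / 2 * (norm (x k - xt k))\<^sup>2 + u k" for k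
    proof (cases "k = 0")
      case True
      moreover have "L / 4 * (norm (x k - xt k))\<^sup>2 \<le> L / 2 * (norm (x k - xt k))\<^sup>2"
        using L by (intro mult_right_mono) auto
      ultimately show ?thesis using upper'[OF in_Q, of k k] by (simp add: u_def)
    qed (use upper[OF in_Q, of k k] in \<open>simp add: u_def\<close>)
    have "(\<Sum>j\<le>N. ?A j * u j + (?A j - ?a j) * ?v j + ?a j * ?w j)
        \<le> (\<Sum>j\<le>N. of_bool (j \<noteq> 0) * (?A N * \<delta>\<^sub>2) + ?a j * (3 * ?R * \<delta>))"
    proof (rule sum_mono)
      fix j assume "j \<in> {..N}"
      then have j: "j \<le> N" by simp
      have vw: "(?A j - ?a j) * ?v j + ?a j * ?w j
          \<le> ?a j * (of_bool (j = 0) + 3 * of_bool (j \<noteq> 0)) * ?R * \<delta>"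
        by (rule stm_gradient_error[OF L order_refl Q r run start \<delta> j])
      \<comment> \<open>At \<open>j = 0\<close> the two radii here and the one in \<open>vw\<close>
        make up the 3; for \<open>j > 0\<close> all three come from \<open>vw\<close>, and
        \<open>?A j\<close> is raised to \<open>?A N\<close>.\<close>
      have u: "?A j * u j \<le> of_bool (j \<noteq> 0) * (?A N * \<delta>\<^sub>2) + of_bool (j = 0) * (?a j * (2 * ?R * \<delta>))"
      proof (cases "j = 0")
        case True
        have "norm (x 0 - xt 0) \<le> 2 * ?R"
          using norm_triangle_ineq4[of "x 0 - x_star" "xt 0 - x_star"]
            stm_radius_ge(2)[of 0 N x x_star xt z] stm_radius_ge(3)[of 0 N xt x_star z x] by (smt (verit) diff_diff_eq2 diff_add_cancel le0)
        then have "1 / L * (\<delta> * norm (x 0 - xt 0)) \<le> 1 / L * (\<delta> * (2 * ?R))"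
          using L \<delta> by (intro mult_left_mono) auto
        then show ?thesis using True by (simp add: u_def mult_ac)
      next
        case False
        then show ?thesis using stm_A_mono[OF L order_refl j] L by (simp add: u_def \<delta>\<^sub>2 mult_right_mono divide_right_mono)
      qed
      show "?A j * u j + (?A j - ?a j) * ?v j + ?a j * ?w j
          \<le> of_bool (j \<noteq> 0) * (?A N * \<delta>\<^sub>2) + ?a j * (3 * ?R * \<delta>)"
        using u vw by (cases "j = 0") (simp_all add: algebra_simps del: stm_A.simps stm_alpha.simps)
    qed
    also have "\<dots> = real N * (?A N * \<delta>\<^sub>2) + ?A N * (3 * ?R * \<delta>)"
    proof -
      have "(\<Sum>j\<le>N. of_bool (j \<noteq> 0)) = real N" by (induction N) auto
      then show ?thesis
        by (simp only: sum.distrib sum_distrib_right[symmetric] sum_stm_alpha[OF L order_refl])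
    qed
    finally have errs: "(\<Sum>j\<le>N. ?A j * u j + (?A j - ?a j) * ?v j + ?a j * ?w j)
        \<le> ?A N * (3 * ?R * \<delta> + real N * \<delta>\<^sub>2)"
      by (simp add: algebra_simps)
    \<comment> \<open>The shift by 2 is given up to reach the rate
      \<open>4 * L / (real N)\<^sup>2\<close>; the division needs \<open>N \<ge> 1\<close>.\<close>
    have "(real N)\<^sup>2 \<le> (real N + 2)\<^sup>2" by (intro power_mono) auto
    also have "\<dots> \<le> 4 * L * ?A N" by (rule stm_A_ge_square[OF L order_refl])
    finally have C: "1 \<le> 4 * L / (real N)\<^sup>2 * ?A N"
      using \<open>N \<ge> 1\<close> by (simp add: field_simps)
    have "\<L> (x N) + r (x N) - (\<L> x_star + r x_star)
        \<le> 4 * L / (real N)\<^sup>2 * R\<^sup>2 + (3 * ?R * \<delta> + real N * \<delta>\<^sub>2)"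
    proof (rule stm_convergence[OF L order_refl Q r run start upper_u _ _ star R errs C])
      show "\<L> (xt k) + ?g (xt k) \<bullet> (x_star - xt k) + 0 / 2 * (norm (x_star - xt k))\<^sup>2
          \<le> \<L> x_star + ?w k" for k
        using lower0[OF in_Q(1) star] by simp
    qed (simp add: lower0 in_Q)
    then show ?thesis by (simp add: f)
  qed

  show ?thesis
    using strong1 strong2 weak \<open>\<mu>\<^sub>1 = \<mu>\<close> \<open>\<delta>\<^sub>1 = \<delta>\<close> by simp
qed

end
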